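(* Let $a,b,c$ be nonzero real numbers, let $w_0,w_1$ be arbitrary real initial values, and let $\{w_n\}$ be the associated generalized bi-periodic Horadam sequence. Let $$U=\begin{pmatrix} ab & cb\\ a & 0\end{pmatrix},\qquad T=\begin{pmatrix} ab\,w_1+cb\,w_0 & cb\,w_1\\ a\,w_1 & cb\,w_0\end{pmatrix}.$$ Then for every integer $n$, $$TU^{n}=(ab)^{\lfloor (n+1)/2\rfloor}\begin{pmatrix} b^{\zeta(n+1)}w_{n+2} & c\,b\,a^{-\zeta(n)}w_{n+1}\\ a^{\zeta(n+1)}w_{n+1} & c\,b^{\zeta(n+1)}w_{n}\end{pmatrix}.$$
   Context: For nonzero real numbers $a,b,c$ and real initial values $w_0,w_1$, the generalized bi-periodic Horadam sequence $\{w_n\}$ is defined by $w_n=\chi(n)w_{n-1}+c\,w_{n-2}$ for $n\ge 2$, where $\chi(n)=a$ if $n$ is even and $\chi(n)=b$ if $n$ is odd. It is extended to negative indices by $w_{-n}=-\frac{a^{\zeta(n+1)}b^{\zeta(n)}}{c}w_{-n+1}+\frac1c w_{-n+2}$ for $n\ge1$ (i.e. the same recurrence run backwards). The parity function is $\zeta(n)=0$ if $n$ is even and $\zeta(n)=1$ if $n$ is odd. *)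

theory Defs
  imports "HOL-Analysis.Analysis"
begin

definition zeta :: "int \<Rightarrow> nat" where
  "zeta n = (if even n then 0 else 1)"

definition chi :: "real \<Rightarrow> real \<Rightarrow> int \<Rightarrow> real" where
  "chi a b n = (if even n then a else b)"

(* The last branch is the backward extension w_{-m} for m = -n \<ge> 1. *)
function horadam :: "real \<Rightarrow> real \<Rightarrow> real \<Rightarrow> real \<Rightarrow> real \<Rightarrow> int \<Rightarrow> real" where
  "horadam a b c w0 w1 n =
     (if n = 0 then w0
      else if n = 1 then w1
      else if n \<ge> 2 then
        chi a b n * horadam a b c w0 w1 (n - 1) + c * horadam a b c w0 w1 (n - 2)
      else
        - (a ^ zeta (- n + 1) * b ^ zeta (- n) / c) * horadam a b c w0 w1 (n + 1)
        + 1 / c * horadam a b c w0 w1 (n + 2))"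
  by pat_completeness auto
termination
  by (relation "Wellfounded.measure (\<lambda>(a, b, c, w0, w1, n). nat (if n \<ge> 0 then n else 1 - n))") auto

declare horadam.simps [simp del]

lemma horadam_0: "horadam a b c w0 w1 0 = w0"
  by (simp add: horadam.simps)

lemma horadam_1: "horadam a b c w0 w1 1 = w1"
  by (simp add: horadam.simps)

lemma horadam_forward:
  assumes "n \<ge> 2"
  shows "horadam a b c w0 w1 n =
    chi a b n * horadam a b c w0 w1 (n - 1) + c * horadam a b c w0 w1 (n - 2)"
  using assms by (subst horadam.simps) simp

lemma horadam_backward:
  assumes "n \<ge> 1"
  shows "horadam a b c w0 w1 (- n) =
    - (a ^ zeta (n + 1) * b ^ zeta n / c) * horadam a b c w0 w1 (- n + 1)
    + 1 / c * horadam a b c w0 w1 (- n + 2)"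
  using assms by (subst horadam.simps) simp

(* The class operation ^ on the vec type is the entrywise power, not the matrix power. *)
primrec matpow :: "'a::semiring_1 ^ 'n ^ 'n \<Rightarrow> nat \<Rightarrow> 'a ^ 'n ^ 'n" where
  "matpow A 0 = mat 1"
| "matpow A (Suc k) = A ** matpow A k"

(* Meaningful for negative k only when A is invertible, since matrix_inv is
   underspecified otherwise. *)
definition matpowi :: "'a::semiring_1 ^ 'n ^ 'n \<Rightarrow> int \<Rightarrow> 'a ^ 'n ^ 'n" where
  "matpowi A k = (if k \<ge> 0 then matpow A (nat k) else matpow (matrix_inv A) (nat (- k)))"

end

(* Write M n for the right-hand side of the formula. Since the backward extension obeys the same
   recurrence as the forward one, M (n + 1) = M n ** U for every integer n, and M 0 = T. *)

theory Submission
  imports Defs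
begin

text \<open>Right multiplication by \<open>U\<close> acts as the index shift on the family
  \<open>M n\<close>: the second column of \<open>U\<close> moves entries along, and the first
  column applies the recurrence. Since det \<open>U\<close> = -abc is nonzero, the shift can also be
  undone, so starting from \<open>M 0 = T\<close> every integer power of \<open>U\<close> is
  reached. \<open>horadam_rec\<close> puts the recurrence in one form for all integers, and
  \<open>mult_matpowi_shift\<close> iterates a one-step shift in both directions.\<close>

text \<open>For negative \<open>n\<close> this is the backward extension multiplied by
  \<open>c\<close>: its coefficient a^\<zeta>(-n+1) b^\<zeta>(-n) is just \<open>chi a b n\<close>,
  and \<open>n\<close> and \<open>n + 2\<close> have the same parity.\<close>

lemma horadam_rec:
  assumes "c \<noteq> 0"
  shows "horadam a b c w0 w1 (n + 2) =
    chi a b n * horadam a b c w0 w1 (n + 1) + c * horadam a b c w0 w1 n"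
proof (cases "n \<ge> 0")
  case True
  then show ?thesis
    using horadam_forward[of "n + 2" a b c w0 w1] by (simp add: chi_def algebra_simps)
next
  case False
  have "a ^ zeta (- n + 1) * b ^ zeta (- n) = chi a b n"
    by (simp add: zeta_def chi_def)
  with False show ?thesis
    using horadam_backward[of "- n" a b c w0 w1] assms by (simp add: field_simps)
qed

lemma matrix_inv_right:
  fixes A :: "'a::semiring_1 ^ 'n ^ 'm"
  assumes "invertible A"
  shows "A ** matrix_inv A = mat 1"
  using assms unfolding invertible_def matrix_inv_def by (rule someI2_ex) blast

text \<open>The increment \<open>d\<close> is left free so that 1 serves \<open>A\<close> and -1
  serves its inverse. As \<open>matpow\<close> splits off its factor on the left, \<open>M n\<close>
  absorbs that factor first, so the induction needs every \<open>n\<close>.\<close>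

lemma mult_matpow_shift:
  assumes "\<And>n. M n ** A = M (n + d)"
  shows "M n ** matpow A k = M (n + d * int k)"
proof (induction k arbitrary: n)
  case 0
  show ?case by (simp add: matrix_mul_rid)
next
  case (Suc k)
  have "M n ** matpow A (Suc k) = M (n + d) ** matpow A k"
    by (simp add: matrix_mul_assoc assms)
  also have "\<dots> = M (n + d * int (Suc k))"
    by (simp add: Suc algebra_simps)
  finally show ?case .
qed

lemma mult_matpowi_shift:
  fixes A :: "'a::semiring_1 ^ 'n ^ 'n" and M :: "int \<Rightarrow> 'a ^ 'n ^ 'm"
  assumes step: "\<And>n. M n ** A = M (n + 1)" and "invertible A"
  shows "M n ** matpowi A k = M (n + k)"
proof -
  \<comment> \<open>Write \<open>M n\<close> as \<open>M (n - 1) ** A\<close> and cancel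
    \<open>A\<close>.\<close>
  have inv_step: "M n ** matrix_inv A = M (n + (- 1))" for n
  proof -
    have "M n ** matrix_inv A = M (n - 1) ** A ** matrix_inv A"
      by (simp add: step)
    also have "\<dots> = M (n - 1)"
      using matrix_inv_right[OF \<open>invertible A\<close>]
      by (simp add: matrix_mul_assoc[symmetric] matrix_mul_rid)
    finally show ?thesis by simp
  qed
  show ?thesis
    using mult_matpow_shift[of M A 1, OF step, of n "nat k"]
      mult_matpow_shift[of M "matrix_inv A" "- 1", OF inv_step, of n "nat (- k)"]
    by (simp add: matpowi_def)
qed

theorem mainTheorem2:
  fixes a b c w0 w1 :: real and n :: int
    and w :: "int \<Rightarrow> real" and U T :: "real ^ 2 ^ 2"
  assumes "a \<noteq> 0" and "b \<noteq> 0" and "c \<noteq> 0"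
  defines "w \<equiv> horadam a b c w0 w1"
  defines "U \<equiv> vector [vector [a * b, c * b],
                       vector [a,     0]]"
  defines "T \<equiv> vector [vector [a * b * w1 + c * b * w0, c * b * w1],
                       vector [a * w1,                  c * b * w0]]"
  shows "T ** matpowi U n =
    ((a * b) powi \<lfloor>real_of_int (n + 1) / 2\<rfloor>) *\<^sub>R
      vector [vector [b ^ zeta (n + 1) * w (n + 2), c * b * a powi (- int (zeta n)) * w (n + 1)],
              vector [a ^ zeta (n + 1) * w (n + 1), c * b ^ zeta (n + 1) * w n]]"
proof -
  define M :: "int \<Rightarrow> real ^ 2 ^ 2" where
    "M n = ((a * b) powi \<lfloor>real_of_int (n + 1) / 2\<rfloor>) *\<^sub>R
      vector [vector [b ^ zeta (n + 1) * w (n + 2), c * b * a powi (- int (zeta n)) * w (n + 1)],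
              vector [a ^ zeta (n + 1) * w (n + 1), c * b ^ zeta (n + 1) * w n]]" for n
  \<comment> \<open>The real floors in \<open>M n\<close> and \<open>M (n + 1)\<close> are integer
    quotients, hence determined by parity.\<close>
  have exponents: "\<lfloor>real_of_int (n + 1) / 2\<rfloor> = k" "\<lfloor>real_of_int (n + 1 + 1) / 2\<rfloor> = l"
    if "(n + 1) div 2 = k" "(n + 2) div 2 = l" for n k l
    using floor_divide_of_int_eq[of "n + 1" 2] floor_divide_of_int_eq[of "n + 2" 2] that
    by (simp_all add: add.assoc)
  have rec: "w (n + 2) = chi a b n * w (n + 1) + c * w n" for n
    unfolding w_def by (rule horadam_rec) fact
  have rec': "w (n + 3) = chi a b (n + 1) * w (n + 2) + c * w (n + 1)" for n
    using rec[of "n + 1"] by (simp add: add.assoc)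
  have powi_succ: "(a * b) powi (1 + k) = a * (b * (a * b) powi k)" for k
    using \<open>a \<noteq> 0\<close> \<open>b \<noteq> 0\<close> by (simp add: power_int_add)
  have step: "M n ** U = M (n + 1)" for n
  \<comment> \<open>For even \<open>n\<close> the exponent grows by one, and every entry of the
    product yields a factor ab. For odd \<open>n\<close> the exponent stays, and the factors
    \<open>a\<close> and \<open>b\<close> that appear are those that \<zeta> puts into the entries
    of \<open>M (n + 1)\<close>.\<close>
  proof (cases "even n")
    case True
    then obtain k where n: "n = 2 * k" by (elim evenE)
    then have d: "\<lfloor>real_of_int (n + 1) / 2\<rfloor> = k" "\<lfloor>real_of_int (n + 1 + 1) / 2\<rfloor> = k + 1"
      by (intro exponents; simp)+
    show ?thesis
      using True \<open>a \<noteq> 0\<close> \<open>b \<noteq> 0\<close> rec[of n] rec'[of n]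
      unfolding M_def d
      by (simp add: U_def add.assoc zeta_def chi_def vec_eq_iff forall_2
          matrix_matrix_mult_def sum_2 powi_succ power_int_minus field_simps)
  next
    case False
    then obtain k where n: "n = 2 * k + 1" by (elim oddE)
    then have d: "\<lfloor>real_of_int (n + 1) / 2\<rfloor> = k + 1" "\<lfloor>real_of_int (n + 1 + 1) / 2\<rfloor> = k + 1"
      by (intro exponents; simp)+
    show ?thesis
      using False \<open>a \<noteq> 0\<close> \<open>b \<noteq> 0\<close> rec[of n] rec'[of n]
      unfolding M_def d
      by (simp add: U_def add.assoc zeta_def chi_def vec_eq_iff forall_2
          matrix_matrix_mult_def sum_2 powi_succ power_int_minus field_simps)
  qed
  have "invertible U"
    using assms(1-3) by (simp add: invertible_det_nz det_2 U_def)
  \<comment> \<open>The exponent is 0 here, and the recurrence turns b w(2) into the top left entry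
    of \<open>T\<close>.\<close>
  moreover have "M 0 = T"
    using rec[of 0]
    by (simp add: M_def T_def zeta_def chi_def vec_eq_iff forall_2 w_def horadam_0 horadam_1
        algebra_simps)
  ultimately have "T ** matpowi U n = M n"
    using mult_matpowi_shift[of M U 0 n, OF step] by simp
  then show ?thesis
    by (simp only: M_def)
qed

end
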